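(* Let $C\subset[0,1]$ be the middle third Cantor set, let $C\times C\subset\mathbb{R}^2$ be its Cartesian product with itself, and let $s=\dim_H(C\times C)=\log_3 4$. Then the $s$-dimensional Hausdorff measure of $C\times C$ satisfies $$H^s(C\times C)\le (\sqrt{2})^{\log_3 4}\quad(\approx 1.548563).$$
   Context: The middle third Cantor set $C$ is the unique nonempty compact set with $C=f_1(C)\cup f_2(C)$, where $f_1(x)=x/3$ and $f_2(x)=(x+2)/3$. The plane $\mathbb{R}^2$ carries the Euclidean metric and $|U|$ denotes the diameter of a set $U$. Hausdorff measure is taken without any normalizing constant: for $\delta>0$, $H^s_\delta(E)=\inf\sum_{i=1}^\infty |U_i|^s$, the infimum being over all countable covers $E\subset\bigcup_i U_i$ with $0<|U_i|\le\delta$, and $H^s(E)=\lim_{\delta\to0^+}H^s_\delta(E)$. *)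

theory Defs
  imports "HOL-Analysis.Analysis"
begin

definition cantor_map1 :: "real \<Rightarrow> real" where
  "cantor_map1 x = x / 3"

definition cantor_map2 :: "real \<Rightarrow> real" where
  "cantor_map2 x = (x + 2) / 3"

definition cantor_set :: "real set" where
  "cantor_set = (THE C. C \<noteq> {} \<and> compact C \<and> C = cantor_map1 ` C \<union> cantor_map2 ` C)"

text \<open>
  In \<open>hausdorff_covers\<close>, boundedness is required explicitly because \<^const>\<open>diameter\<close> is a
  supremum in the reals and carries no information for unbounded sets. A finite cover enters
  only after being padded to a sequence by sets of small positive diameter; in Euclidean space
  this does not affect the infimum for a positive exponent, nor the Hausdorff dimension.
\<close>

definition hausdorff_covers :: "real \<Rightarrow> 'a::metric_space set \<Rightarrow> (nat \<Rightarrow> 'a set) set" where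
  "hausdorff_covers \<delta> E =
    {U. E \<subseteq> (\<Union>i. U i) \<and> (\<forall>i. bounded (U i) \<and> 0 < diameter (U i) \<and> diameter (U i) \<le> \<delta>)}"

definition hausdorff_premeasure :: "real \<Rightarrow> real \<Rightarrow> 'a::metric_space set \<Rightarrow> ennreal" where
  "hausdorff_premeasure s \<delta> E =
    (INF U \<in> hausdorff_covers \<delta> E. \<Sum>i. ennreal (diameter (U i) powr s))"

definition hausdorff_measure :: "real \<Rightarrow> 'a::metric_space set \<Rightarrow> ennreal" where
  "hausdorff_measure s E = Lim (at_right 0) (\<lambda>\<delta>. hausdorff_premeasure s \<delta> E)"

definition hausdorff_dim :: "'a::metric_space set \<Rightarrow> ereal" where
  "hausdorff_dim E = (INF s \<in> {s. 0 \<le> s \<and> hausdorff_measure s E = 0}. ereal s)"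

text \<open>The limit in \<open>hausdorff_measure\<close> and the set in \<open>cantor_set\<close> exist and are unique.\<close>

lemma hausdorff_premeasure_antimono:
  assumes "\<delta> \<le> \<delta>'"
  shows "hausdorff_premeasure s \<delta>' E \<le> hausdorff_premeasure s \<delta> E"
  unfolding hausdorff_premeasure_def
  by (rule INF_superset_mono) (use assms in \<open>auto simp: hausdorff_covers_def intro: order_trans\<close>)

lemma hausdorff_premeasure_tendsto:
  "((\<lambda>\<delta>. hausdorff_premeasure s \<delta> E) \<longlongrightarrow> (SUP \<delta>\<in>{0<..}. hausdorff_premeasure s \<delta> E)) (at_right 0)"
proof (rule increasing_tendsto)
  show "\<forall>\<^sub>F \<delta> in at_right 0. hausdorff_premeasure s \<delta> E \<le> (SUP \<delta>\<in>{0<..}. hausdorff_premeasure s \<delta> E)"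
    unfolding eventually_at_right_field by (auto intro!: exI[of _ 1] SUP_upper)
next
  fix x assume "x < (SUP \<delta>\<in>{0<..}. hausdorff_premeasure s \<delta> E)"
  then obtain d where d: "d > 0" "x < hausdorff_premeasure s d E"
    by (auto simp: less_SUP_iff)
  have "x < hausdorff_premeasure s \<delta> E" if "\<delta> < d" for \<delta>
    using d(2) hausdorff_premeasure_antimono[of \<delta> d s E] that by (simp add: less_le_trans)
  then show "\<forall>\<^sub>F \<delta> in at_right 0. x < hausdorff_premeasure s \<delta> E"
    unfolding eventually_at_right_field using d(1) by blast
qed

lemma hausdorff_measure_eq_SUP:
  "hausdorff_measure s E = (SUP \<delta>\<in>{0<..}. hausdorff_premeasure s \<delta> E)"
  unfolding hausdorff_measure_def
  by (rule tendsto_Lim[OF _ hausdorff_premeasure_tendsto]) simp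

lemma cantor_invariant_subset:
  assumes A: "compact A" "A = cantor_map1 ` A \<union> cantor_map2 ` A"
    and B: "compact B" "B \<noteq> {}" "B = cantor_map1 ` B \<union> cantor_map2 ` B"
  shows "A \<subseteq> B"
proof (cases "A = {}")
  case False
  have "continuous_on A (\<lambda>x. infdist x B)"
    by (intro continuous_intros)
  then obtain a where a: "a \<in> A" "\<And>x. x \<in> A \<Longrightarrow> infdist x B \<le> infdist a B"
    using continuous_attains_sup[OF A(1) False] by blast
  obtain f a' where f: "f = cantor_map1 \<or> f = cantor_map2" "a' \<in> A" "a = f a'"
    using a(1) A(2) by blast
  obtain b where b: "b \<in> B" "infdist a' B = dist a' b"
    using infdist_attains_inf[OF compact_imp_closed[OF B(1)] B(2)] by blast
  have "f b \<in> B"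
    using f(1) b(1) B(3) by blast
  then have "infdist a B \<le> dist (f a') (f b)"
    using f(3) infdist_le by auto
  also have "\<dots> = infdist a' B / 3"
  proof -
    have "f a' - f b = (a' - b) / 3"
      using f(1) by (auto simp: cantor_map1_def cantor_map2_def field_simps)
    then show ?thesis
      using b(2) unfolding dist_real_def by (simp only: abs_divide abs_numeral)
  qed
  also have "\<dots> \<le> infdist a B / 3"
    using a(2)[OF f(2)] by simp
  finally have "infdist a B \<le> 0" by simp
  then have "infdist x B = 0" if "x \<in> A" for x
    using a(2)[OF that] infdist_nonneg[of x B] by linarith
  then show ?thesis
    using in_closed_iff_infdist_zero[OF compact_imp_closed[OF B(1)] B(2)] by blast
qed auto

lemma cantor_set_ex1:
  "\<exists>!C. C \<noteq> {} \<and> compact C \<and> C = cantor_map1 ` C \<union> cantor_map2 ` C"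
proof -
  define F where "F S = cantor_map1 ` S \<union> cantor_map2 ` S" for S
  define K where "K n = (F ^^ n) {0..1}" for n
  have K0: "K 0 = {0..1}" and KSuc: "K (Suc n) = F (K n)" for n
    by (auto simp: K_def)
  have mono: "F S \<subseteq> F T" if "S \<subseteq> T" for S T
    using that by (auto simp: F_def)
  have comp: "compact (K n)" for n
  proof (induction n)
    case (Suc n)
    have "continuous_on (K n) cantor_map1" "continuous_on (K n) cantor_map2"
      unfolding cantor_map1_def cantor_map2_def by (intro continuous_intros; simp)+
    then show ?case
      using Suc by (auto simp: KSuc F_def intro!: compact_Un compact_continuous_image)
  qed (simp add: K0)
  have K1: "K n \<subseteq> {0..1}" for n
  proof (induction n)
    case (Suc n)
    then show ?case
      by (force simp: KSuc F_def cantor_map1_def cantor_map2_def)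
  qed (simp add: K0)
  have dec: "K (Suc n) \<subseteq> K n" for n
  proof (induction n)
    case 0
    show ?case using K1[of 1] K0 by simp
  next
    case (Suc n)
    show ?case using mono[OF Suc] by (simp add: KSuc)
  qed
  have zero: "0 \<in> K n" for n
  proof (induction n)
    case (Suc n)
    then show ?case
      by (auto simp: KSuc F_def cantor_map1_def image_iff intro!: bexI[of _ 0])
  qed (simp add: K0)
  define C where "C = (\<Inter>n. K n)"
  have "compact C"
    unfolding C_def
    by (rule compact_Inter[of "range K", simplified]) (use comp in auto)
  moreover have "C \<noteq> {}"
    using zero by (auto simp: C_def)
  moreover have "F C \<subseteq> C"
  proof -
    have "F C \<subseteq> K n" for n
    proof -
      have "F C \<subseteq> F (K n)" by (rule mono) (auto simp: C_def)
      then show ?thesis using dec[of n] KSuc by auto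
    qed
    then show ?thesis by (auto simp: C_def)
  qed
  moreover have "C \<subseteq> F C"
  proof
    fix x assume "x \<in> C"
    then have x: "x \<in> F (K n)" for n
      unfolding C_def using KSuc by (metis INT_E UNIV_I)
    show "x \<in> F C"
    proof (cases "x \<le> 1 / 3")
      case True
      have "3 * x \<in> K n" for n
        using x[of n] K1[of n] True by (force simp: F_def cantor_map1_def cantor_map2_def)
      then have "3 * x \<in> C" by (simp add: C_def)
      moreover have "x = cantor_map1 (3 * x)" by (simp add: cantor_map1_def)
      ultimately show ?thesis unfolding F_def by blast
    next
      case False
      have "3 * x - 2 \<in> K n" for n
      proof -
        have "x \<notin> cantor_map1 ` K n"
          using K1[of n] False by (fastforce simp: cantor_map1_def)
        then obtain y where y: "y \<in> K n" "x = cantor_map2 y"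
          using x[of n] unfolding F_def by blast
        have "3 * x - 2 = y"
          unfolding y(2) by (simp add: cantor_map2_def field_simps)
        then show ?thesis
          using y(1) by (rule ssubst)
      qed
      then have "3 * x - 2 \<in> C" by (simp add: C_def)
      moreover have "x = cantor_map2 (3 * x - 2)" by (simp add: cantor_map2_def)
      ultimately show ?thesis unfolding F_def by blast
    qed
  qed
  ultimately have "C \<noteq> {} \<and> compact C \<and> C = cantor_map1 ` C \<union> cantor_map2 ` C"
    unfolding F_def by blast
  note C = this
  have "D = C" if D: "D \<noteq> {} \<and> compact D \<and> D = cantor_map1 ` D \<union> cantor_map2 ` D" for D
  proof (rule equalityI)
    show "D \<subseteq> C"
      by (rule cantor_invariant_subset) (fact conjunct1[OF D] conjunct1[OF conjunct2[OF D]]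
          conjunct2[OF conjunct2[OF D]] conjunct1[OF C] conjunct1[OF conjunct2[OF C]]
          conjunct2[OF conjunct2[OF C]])+
    show "C \<subseteq> D"
      by (rule cantor_invariant_subset) (fact conjunct1[OF D] conjunct1[OF conjunct2[OF D]]
          conjunct2[OF conjunct2[OF D]] conjunct1[OF C] conjunct1[OF conjunct2[OF C]]
          conjunct2[OF conjunct2[OF C]])+
  qed
  with C show ?thesis by (rule ex1I)
qed

lemma cantor_set_props:
  "cantor_set \<noteq> {}" "compact cantor_set"
  "cantor_set = cantor_map1 ` cantor_set \<union> cantor_map2 ` cantor_set"
proof -
  note * = theI'[OF cantor_set_ex1, folded cantor_set_def]
  show "cantor_set \<noteq> {}" by (rule conjunct1[OF *])
  show "compact cantor_set" by (rule conjunct1[OF conjunct2[OF *]])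
  show "cantor_set = cantor_map1 ` cantor_set \<union> cantor_map2 ` cantor_set"
    by (rule conjunct2[OF conjunct2[OF *]])
qed

end

theory Submission imports Defs begin

text \<open>
  The set \<open>C \<times> C\<close>, where \<open>C\<close> is the Cantor set, is covered by the \<open>4\<^sup>n\<close> triadic squares of
  side \<open>1 / 3\<^sup>n\<close>, each of diameter \<open>\<surd>2 / 3\<^sup>n\<close>. Their \<open>s\<close>-dimensional sum is
  \<open>(\<surd>2)\<^sup>s (4 / 3\<^sup>s)\<^sup>n\<close>. At \<open>s = log 3 4\<close> the second factor is 1 for every \<open>n\<close>, which gives the
  bound on the measure (\<open>hausdorff_measure_cantor_square_le\<close>); for larger \<open>s\<close> the sum tends to 0,
  so the dimension is at most \<open>log 3 4\<close> (\<open>hausdorff_measure_cantor_square_zero\<close>).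

  For the lower bound on the dimension, \<open>C \<times> C\<close> is compared with the unit square under Lebesgue
  measure. Replacing the binary digits 0, 1 of \<open>t \<in> [0, 1)\<close> by the ternary digits 0, 2 gives a point
  of \<open>C\<close>; this map, \<open>binary_to_ternary\<close>, is a right inverse of the Cantor function. Points whose
  images are closer than \<open>1 / 3\<^sup>n\<close> lie within \<open>1 / 2\<^sup>n\<close> of each other, that is, the inverse is
  Hoelder continuous with exponent \<open>log 3 2\<close> (\<open>binary_to_ternary_inverse_modulus\<close>). Hence the
  preimage in the unit square of a planar set of small diameter \<open>d\<close> fits into a square of area at
  most \<open>16 d\<^sup>s\<close> with \<open>s = 2 log 3 2 = log 3 4\<close>. The preimages of the sets of a cover of \<open>C \<times> C\<close>
  cover the unit square, so subadditivity of Lebesgue measure gives \<open>1 \<le> 16 \<Sum> d\<^sub>i\<^sup>s\<close>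
  (\<open>one_le_hausdorff_cover_sum\<close>). This keeps the \<open>s\<close>-dimensional measure away from 0
  without constructing a mass distribution on \<open>C \<times> C\<close>.
\<close>

section \<open>Expanding binary digits in base three\<close>

definition binary_digit :: "nat \<Rightarrow> real \<Rightarrow> int" where
  "binary_digit k t = \<lfloor>2 ^ Suc k * t\<rfloor> mod 2"

definition binary_to_ternary :: "real \<Rightarrow> real" where
  "binary_to_ternary t = (\<Sum>k. 2 * real_of_int (binary_digit k t) / 3 ^ Suc k)"

lemma binary_digit_bounds: "0 \<le> binary_digit k t" "binary_digit k t \<le> 1"
  unfolding binary_digit_def by (simp, linarith)

lemma sums_ternary_twos: "(\<lambda>k. 2 / 3 ^ Suc k :: real) sums 1"
  using sums_mult[OF geometric_sums[of "1/3::real"], of "2/3"]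
  by (simp add: power_divide)

lemma summable_binary_to_ternary:
  "summable (\<lambda>k. 2 * real_of_int (binary_digit k t) / 3 ^ Suc k)"
  by (rule summable_comparison_test'[OF sums_summable[OF sums_ternary_twos], of 0])
     (use binary_digit_bounds in \<open>auto simp: divide_right_mono\<close>)

lemma binary_to_ternary_bounds: "0 \<le> binary_to_ternary t" "binary_to_ternary t \<le> 1"
proof -
  show "0 \<le> binary_to_ternary t"
    unfolding binary_to_ternary_def
    by (rule suminf_nonneg[OF summable_binary_to_ternary]) (simp add: binary_digit_bounds)
  have "binary_to_ternary t \<le> (\<Sum>k. 2 / 3 ^ Suc k :: real)"
    unfolding binary_to_ternary_def
    by (rule suminf_le[OF _ summable_binary_to_ternary sums_summable[OF sums_ternary_twos]])
       (use binary_digit_bounds in \<open>auto simp: divide_right_mono\<close>)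
  then show "binary_to_ternary t \<le> 1"
    using sums_unique[OF sums_ternary_twos] by simp
qed

text \<open>
  Digit \<open>k\<close> carries weight \<open>1 / 3 ^ Suc k\<close>, so removing the leading digit of the expansion scales
  the rest by 3. The next two lemmas read this as equivariance: halving in the domain corresponds to
  the two contractions that generate the Cantor set.
\<close>

lemma binary_to_ternary_shift:
  assumes "\<And>k. binary_digit (Suc k) t = binary_digit k u"
  shows "binary_to_ternary t = (2 * real_of_int (binary_digit 0 t) + binary_to_ternary u) / 3"
proof -
  have "binary_to_ternary t = 2 * real_of_int (binary_digit 0 t) / 3
      + (\<Sum>k. 2 * real_of_int (binary_digit (Suc k) t) / 3 ^ Suc (Suc k))"
    unfolding binary_to_ternary_def
    using suminf_split_head[OF summable_binary_to_ternary[of t]] by simp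
  also have "(\<Sum>k. 2 * real_of_int (binary_digit (Suc k) t) / 3 ^ Suc (Suc k))
      = (\<Sum>k. (2 * real_of_int (binary_digit k u) / 3 ^ Suc k) / 3)"
    by (simp add: assms field_simps)
  also have "\<dots> = binary_to_ternary u / 3"
    unfolding binary_to_ternary_def by (rule suminf_divide[OF summable_binary_to_ternary])
  finally show ?thesis by (simp add: add_divide_distrib)
qed

lemma binary_to_ternary_lower_half:
  assumes "0 \<le> t" "t < 1"
  shows "binary_to_ternary (t / 2) = cantor_map1 (binary_to_ternary t)"
proof -
  have "binary_digit 0 (t / 2) = 0"
    using assms by (simp add: binary_digit_def floor_eq_iff)
  moreover have "binary_digit (Suc k) (t / 2) = binary_digit k t" for k
    by (simp add: binary_digit_def mult.commute mult.left_commute)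
  ultimately show ?thesis
    using binary_to_ternary_shift[of "t / 2" t] by (simp add: cantor_map1_def)
qed

lemma binary_to_ternary_upper_half:
  assumes "0 \<le> t" "t < 1"
  shows "binary_to_ternary ((t + 1) / 2) = cantor_map2 (binary_to_ternary t)"
proof -
  have "\<lfloor>t + 1\<rfloor> = 1"
    using assms by linarith
  moreover have "2 ^ Suc 0 * ((t + 1) / 2) = t + 1"
    by simp
  ultimately have "binary_digit 0 ((t + 1) / 2) = 1"
    unfolding binary_digit_def by (simp only:) simp
  moreover have "binary_digit (Suc k) ((t + 1) / 2) = binary_digit k t" for k
  proof -
    have "2 ^ Suc (Suc k) * ((t + 1) / 2) = 2 ^ Suc k * t + real_of_int (2 ^ Suc k)"
      by (simp add: field_simps)
    then have "\<lfloor>2 ^ Suc (Suc k) * ((t + 1) / 2)\<rfloor> = \<lfloor>2 ^ Suc k * t\<rfloor> + 2 ^ Suc k"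
      by (simp only: floor_add_int)
    then show ?thesis
      unfolding binary_digit_def by simp
  qed
  ultimately show ?thesis
    using binary_to_ternary_shift[of "(t + 1) / 2" t]
    by (simp add: cantor_map2_def add.commute)
qed

lemma unit_interval_halves:
  fixes t :: real
  assumes "0 \<le> t" "t < 1"
  obtains u where "0 \<le> u" "u < 1" "t = u / 2"
  | u where "0 \<le> u" "u < 1" "t = (u + 1) / 2"
proof (cases "t < 1 / 2")
  case True
  then show ?thesis using assms that(1)[of "2 * t"] by simp
next
  case False
  then show ?thesis using assms that(2)[of "2 * t - 1"] by simp
qed

text \<open>
  By the halving rules the image of \<open>[0, 1)\<close> satisfies the self-similarity equation of the Cantor set,
  but it is not compact: right endpoints of removed gaps are attained, left ones are not. Its closure
  satisfies the equation too, because continuous images of compact sets are closed, and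
  uniqueness of the compact invariant set identifies it. The description puts the image inside the
  Cantor set and the Cantor set inside \<open>[0, 1]\<close>.
\<close>

lemma cantor_set_eq_closure: "cantor_set = closure (binary_to_ternary ` {0..<1})"
proof -
  let ?H = "binary_to_ternary ` {0..<1}"
  have H: "?H = cantor_map1 ` ?H \<union> cantor_map2 ` ?H"
  proof (intro equalityI subsetI)
    fix x assume "x \<in> ?H"
    then obtain t where t: "0 \<le> t" "t < 1" and x: "x = binary_to_ternary t" by auto
    from t show "x \<in> cantor_map1 ` ?H \<union> cantor_map2 ` ?H"
    proof (cases rule: unit_interval_halves)
      case (1 u)
      then show ?thesis using x binary_to_ternary_lower_half[of u] by auto
    next
      case (2 u)
      have "x = cantor_map2 (binary_to_ternary u)"
        unfolding x 2(3) by (rule binary_to_ternary_upper_half[OF 2(1,2)])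
      moreover have "u \<in> {0..<1}" using 2 by simp
      ultimately show ?thesis by blast
    qed
  next
    fix x assume "x \<in> cantor_map1 ` ?H \<union> cantor_map2 ` ?H"
    then consider t where "0 \<le> t" "t < 1" "x = cantor_map1 (binary_to_ternary t)"
      | t where "0 \<le> t" "t < 1" "x = cantor_map2 (binary_to_ternary t)" by auto
    then show "x \<in> ?H"
    proof cases
      case 1
      then have "x = binary_to_ternary (t / 2)" by (simp add: binary_to_ternary_lower_half)
      then show ?thesis using 1 by auto
    next
      case 2
      then have "x = binary_to_ternary ((t + 1) / 2)" by (simp add: binary_to_ternary_upper_half)
      then show ?thesis using 2 by auto
    qed
  qed
  have "bounded ?H"
    by (rule bounded_subset[of "{0..1}"]) (auto simp: binary_to_ternary_bounds)
  then have compact: "compact (closure ?H)" by simp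
  have closure_image: "closure (f ` ?H) = f ` closure ?H" if f: "f = cantor_map1 \<or> f = cantor_map2" for f
  proof (rule closure_unique)
    have cont: "continuous_on S f" for S
      using f unfolding cantor_map1_def cantor_map2_def
      by (elim disjE; simp) (intro continuous_intros; simp)+
    show "f ` ?H \<subseteq> f ` closure ?H"
      by (rule image_mono[OF closure_subset])
    show "closed (f ` closure ?H)"
      by (rule compact_imp_closed[OF compact_continuous_image[OF cont compact]])
    show "f ` closure ?H \<subseteq> T" if "f ` ?H \<subseteq> T" "closed T" for T
      by (rule image_closure_subset[OF cont that(2,1)])
  qed
  have "closure ?H = closure (cantor_map1 ` ?H) \<union> closure (cantor_map2 ` ?H)"
    by (subst H) (rule closure_Un)
  then have inv: "closure ?H = cantor_map1 ` closure ?H \<union> cantor_map2 ` closure ?H"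
    unfolding closure_image[OF disjI1[OF refl]] closure_image[OF disjI2[OF refl]] .
  have nonempty: "closure ?H \<noteq> {}" by simp
  show ?thesis
    by (rule subset_antisym[OF
          cantor_invariant_subset[OF cantor_set_props(2,3) compact nonempty inv]
          cantor_invariant_subset[OF compact inv cantor_set_props(2,1,3)]])
qed

lemma binary_to_ternary_in_cantor_set:
  "0 \<le> t \<Longrightarrow> t < 1 \<Longrightarrow> binary_to_ternary t \<in> cantor_set"
  unfolding cantor_set_eq_closure by (rule subsetD[OF closure_subset]) simp

lemma cantor_set_subset_unit_interval: "cantor_set \<subseteq> {0..1}"
  unfolding cantor_set_eq_closure
  by (rule closure_minimal) (auto simp: binary_to_ternary_bounds)

text \<open>
  Images of the two halves of \<open>[0, 1)\<close> lie in \<open>[0, 1/3]\<close> and \<open>[2/3, 1]\<close>. If the images of \<open>t\<close> and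
  \<open>u\<close> are closer than \<open>1/3\<close>, both points therefore lie in the same half, and rescaling that half to
  \<open>[0, 1)\<close> doubles their distance while tripling the distance of the images.
\<close>

lemma binary_to_ternary_inverse_modulus:
  assumes "0 \<le> t" "t < 1" "0 \<le> u" "u < 1"
    and "\<bar>binary_to_ternary t - binary_to_ternary u\<bar> < 1 / 3 ^ n"
  shows "\<bar>t - u\<bar> \<le> 1 / 2 ^ n"
  using assms
proof (induction n arbitrary: t u)
  case 0
  then show ?case by auto
next
  case (Suc n)
  have small: "\<bar>binary_to_ternary t - binary_to_ternary u\<bar> < 1 / 3"
  proof -
    have "(1::real) / 3 ^ Suc n \<le> 1 / 3" by (simp add: field_simps)
    then show ?thesis using Suc.prems(5) by linarith
  qed
  note halves = binary_to_ternary_lower_half binary_to_ternary_upper_half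
    cantor_map1_def cantor_map2_def
  have step: "\<bar>t - u\<bar> \<le> 1 / 2 ^ Suc n"
    if "0 \<le> t'" "t' < 1" "0 \<le> u'" "u' < 1" "t - u = (t' - u') / 2"
      "binary_to_ternary t - binary_to_ternary u
        = (binary_to_ternary t' - binary_to_ternary u') / 3" for t' u'
  proof -
    have "\<bar>binary_to_ternary t' - binary_to_ternary u'\<bar> < 1 / 3 ^ n"
      using Suc.prems(5) that(6) by (simp add: field_simps)
    then have "\<bar>t' - u'\<bar> \<le> 1 / 2 ^ n"
      using Suc.IH that by blast
    then show ?thesis unfolding that(5) by (simp add: field_simps)
  qed
  from Suc.prems(1,2) show ?case
  proof (cases rule: unit_interval_halves)
    case t: (1 t')
    from Suc.prems(3,4) show ?thesis
    proof (cases rule: unit_interval_halves)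
      case u: (1 u')
      show ?thesis
        by (rule step[of t' u']) (use t(1,2) u(1,2) in \<open>simp_all add: t(3) u(3) halves flip: diff_divide_distrib\<close>)
    next
      case u: (2 u')
      have "binary_to_ternary t = binary_to_ternary t' / 3" "binary_to_ternary u = (binary_to_ternary u' + 2) / 3"
        unfolding t(3) u(3) using t(1,2) u(1,2) by (simp_all only: halves)
      then have False
        using small binary_to_ternary_bounds[of t'] binary_to_ternary_bounds[of u']
        by (simp add: abs_less_iff)
      then show ?thesis ..
    qed
  next
    case t: (2 t')
    from Suc.prems(3,4) show ?thesis
    proof (cases rule: unit_interval_halves)
      case u: (1 u')
      have "binary_to_ternary t = (binary_to_ternary t' + 2) / 3" "binary_to_ternary u = binary_to_ternary u' / 3"
        unfolding t(3) u(3) using t(1,2) u(1,2) by (simp_all only: halves)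
      then have False
        using small binary_to_ternary_bounds[of t'] binary_to_ternary_bounds[of u']
        by (simp add: abs_less_iff)
      then show ?thesis ..
    next
      case u: (2 u')
      show ?thesis
        by (rule step[of t' u']) (use t(1,2) u(1,2) in \<open>simp_all add: t(3) u(3) halves flip: diff_divide_distrib\<close>)
    qed
  qed
qed

section \<open>Lower bound for the premeasures\<close>

lemma triadic_powr_log_3_4: "(1 / 3 ^ n) powr log 3 4 = (1 / 4 ^ n :: real)"
proof -
  have "(3 ^ n) powr log 3 4 = (3 powr log 3 4 :: real) ^ n"
    by (induction n) (simp_all add: powr_mult)
  then show ?thesis by (simp add: powr_divide)
qed

text \<open>
  If \<open>1 / 3 ^ Suc n \<le> diameter U < 1 / 3 ^ n\<close>, all preimages of points of \<open>U\<close> have coordinates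
  within \<open>1 / 2\<^sup>n\<close> of those of any one of them. The square of that radius has area
  \<open>4 / 4\<^sup>n = 16 / 4 ^ Suc n\<close>, and \<open>1 / 4 ^ Suc n\<close> is the power \<open>log 3 4\<close> of \<open>1 / 3 ^ Suc n\<close>. A
  superset \<open>Q\<close> of the preimage is produced instead of the preimage itself because \<open>U\<close> is arbitrary
  and its preimage may fail to be measurable.
\<close>

lemma binary_to_ternary_preimage_cover:
  fixes U :: "(real \<times> real) set"
  assumes U: "bounded U" "0 < diameter U" "diameter U < 1"
  obtains Q where "Q \<in> sets lborel"
    "\<And>t u. t \<in> {0..<1} \<Longrightarrow> u \<in> {0..<1} \<Longrightarrow> (binary_to_ternary t, binary_to_ternary u) \<in> U \<Longrightarrow> (t, u) \<in> Q"
    "emeasure lborel Q \<le> ennreal (16 * diameter U powr log 3 4)"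
proof -
  let ?P = "\<lambda>p. fst p \<in> {0..<1} \<and> snd p \<in> {0..<1} \<and>
     (binary_to_ternary (fst p), binary_to_ternary (snd p)) \<in> U"
  show ?thesis
  proof (cases "\<exists>p. ?P p")
    case False
    then show ?thesis by (intro that[of "{}"]) auto
  next
    case True
    then obtain a b where ab: "a \<in> {0..<1}" "b \<in> {0..<1}"
      "(binary_to_ternary a, binary_to_ternary b) \<in> U" by auto
    have "\<exists>n. 1 / 3 ^ n \<le> diameter U"
      using real_arch_pow_inv[OF U(2), of "1/3"] by (auto simp: power_divide intro: less_imp_le)
    then obtain m where m: "1 / 3 ^ m \<le> diameter U" "\<And>k. k < m \<Longrightarrow> \<not> 1 / 3 ^ k \<le> diameter U"
      using exists_least_iff[of "\<lambda>n. 1 / 3 ^ n \<le> diameter U"] by blast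
    \<comment> \<open>The strict bound on the diameter excludes scale 0, so the previous scale exists.\<close>
    have "m \<noteq> 0" using m(1) U(3) by (cases m) auto
    then obtain n where n: "m = Suc n" by (cases m) auto
    have less: "diameter U < 1 / 3 ^ n" using m(2)[of n] n by simp
    define r :: real where "r = 1 / 2 ^ n"
    have r: "r \<ge> 0" by (simp add: r_def)
    let ?Q = "cbox (a - r, b - r) (a + r, b + r)"
    show ?thesis
    proof (rule that[of ?Q])
      show "?Q \<in> sets lborel" by simp
      fix t u :: real
      assume tu: "t \<in> {0..<1}" "u \<in> {0..<1}" "(binary_to_ternary t, binary_to_ternary u) \<in> U"
      have d: "dist (binary_to_ternary t, binary_to_ternary u)
          (binary_to_ternary a, binary_to_ternary b) < 1 / 3 ^ n"
        using diameter_bounded_bound[OF U(1) tu(3) ab(3)] less by linarith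
      have "\<bar>t - a\<bar> \<le> r" unfolding r_def
        using tu ab d dist_fst_le[of "(binary_to_ternary t, binary_to_ternary u)"
          "(binary_to_ternary a, binary_to_ternary b)"]
        by (intro binary_to_ternary_inverse_modulus) (auto simp: dist_real_def)
      moreover have "\<bar>u - b\<bar> \<le> r" unfolding r_def
        using tu ab d dist_snd_le[of "(binary_to_ternary t, binary_to_ternary u)"
          "(binary_to_ternary a, binary_to_ternary b)"]
        by (intro binary_to_ternary_inverse_modulus) (auto simp: dist_real_def)
      ultimately show "(t, u) \<in> ?Q" by (auto simp: cbox_Pair_eq)
    next
      have "emeasure lborel ?Q = ennreal (4 * r\<^sup>2)"
      proof -
        have B: "(Basis :: (real \<times> real) set) = {(1, 0), (0, 1)}"
          by (auto simp: Basis_prod_def)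
        show ?thesis
          using r by (subst emeasure_lborel_cbox) (auto simp: B power2_eq_square)
      qed
      also have "4 * r\<^sup>2 = 16 * (1 / 3 ^ m) powr log 3 4"
        unfolding triadic_powr_log_3_4 by (simp add: r_def n power2_eq_square power_mult_distrib[symmetric])
      also have "ennreal \<dots> \<le> ennreal (16 * diameter U powr log 3 4)"
        using m(1) by (intro ennreal_leI mult_left_mono powr_mono2) auto
      finally show "emeasure lborel ?Q \<le> ennreal (16 * diameter U powr log 3 4)" .
    qed
  qed
qed

lemma one_le_hausdorff_cover_sum:
  assumes U: "U \<in> hausdorff_covers \<delta> (cantor_set \<times> cantor_set)" and "\<delta> < 1"
  shows "1 \<le> 16 * (\<Sum>i. ennreal (diameter (U i) powr log 3 4))"
proof -
  have "\<exists>Q. Q \<in> sets lborel \<and>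
    (\<forall>t\<in>{0..<1}. \<forall>u\<in>{0..<1}. (binary_to_ternary t, binary_to_ternary u) \<in> U i \<longrightarrow> (t, u) \<in> Q) \<and>
    emeasure lborel Q \<le> ennreal (16 * diameter (U i) powr log 3 4)" for i
  proof -
    have *: "bounded (U i)" "0 < diameter (U i)" "diameter (U i) < 1"
      using U \<open>\<delta> < 1\<close> unfolding hausdorff_covers_def by (auto intro: le_less_trans)
    show ?thesis by (rule binary_to_ternary_preimage_cover[OF *]) blast
  qed
  then obtain Q where Q: "\<And>i. Q i \<in> sets lborel"
    "\<And>i t u. t \<in> {0..<1} \<Longrightarrow> u \<in> {0..<1} \<Longrightarrow> (binary_to_ternary t, binary_to_ternary u) \<in> U i
       \<Longrightarrow> (t, u) \<in> Q i"
    "\<And>i. emeasure lborel (Q i) \<le> ennreal (16 * diameter (U i) powr log 3 4)"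
    by metis
  have B: "(Basis :: (real \<times> real) set) = {(1, 0), (0, 1)}"
    by (auto simp: Basis_prod_def)
  have "1 = emeasure lborel (box (0, 0) (1, 1) :: (real \<times> real) set)"
    by (subst emeasure_lborel_box) (auto simp: B)
  also have "\<dots> \<le> emeasure lborel (\<Union>i. Q i)"
  proof (rule emeasure_mono)
    show "box (0, 0) (1, 1) \<subseteq> (\<Union>i. Q i)"
    proof
      fix p :: "real \<times> real" assume p: "p \<in> box (0, 0) (1, 1)"
      obtain t u where tu: "p = (t, u)" by (cases p)
      have *: "t \<in> {0..<1}" "u \<in> {0..<1}"
        using p by (auto simp: tu mem_box B)
      then have "(binary_to_ternary t, binary_to_ternary u) \<in> cantor_set \<times> cantor_set"
        by (simp add: binary_to_ternary_in_cantor_set)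
      then obtain i where "(binary_to_ternary t, binary_to_ternary u) \<in> U i"
        using U unfolding hausdorff_covers_def by blast
      then show "p \<in> (\<Union>i. Q i)" using Q(2) * tu by blast
    qed
  qed (use Q in auto)
  also have "\<dots> \<le> (\<Sum>i. emeasure lborel (Q i))"
    by (rule emeasure_subadditive_countably) (use Q in auto)
  also have "\<dots> \<le> (\<Sum>i. 16 * ennreal (diameter (U i) powr log 3 4))"
    by (rule suminf_le) (use Q(3) in \<open>auto simp: ennreal_mult\<close>)
  also have "\<dots> = 16 * (\<Sum>i. ennreal (diameter (U i) powr log 3 4))"
    by simp
  finally show ?thesis .
qed

text \<open>
  Only sets of diameter below 1 are admitted in the premeasure at scale \<open>1/2\<close>, and for those a smaller
  exponent gives a larger power; so the bound at exponent \<open>log 3 4\<close> passes to all smaller ones.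
\<close>

lemma hausdorff_measure_cantor_square_nonzero:
  assumes "s \<le> log 3 4"
  shows "hausdorff_measure s (cantor_set \<times> cantor_set) \<noteq> 0"
proof -
  have "1 / 16 \<le> hausdorff_premeasure s (1 / 2) (cantor_set \<times> cantor_set)"
    unfolding hausdorff_premeasure_def
  proof (rule INF_greatest)
    fix U assume U: "U \<in> hausdorff_covers (1 / 2) (cantor_set \<times> cantor_set)"
    have "1 / 16 \<le> (\<Sum>i. ennreal (diameter (U i) powr log 3 4))"
      by (rule divide_le_posI_ennreal[OF _ one_le_hausdorff_cover_sum[OF U]]) simp_all
    also have "\<dots> \<le> (\<Sum>i. ennreal (diameter (U i) powr s))"
    proof (rule suminf_le)
      fix i
      have "0 < diameter (U i)" "diameter (U i) \<le> 1 / 2"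
        using U unfolding hausdorff_covers_def by auto
      then show "ennreal (diameter (U i) powr log 3 4) \<le> ennreal (diameter (U i) powr s)"
        using assms by (intro ennreal_leI powr_mono') auto
    qed auto
    finally show "1 / 16 \<le> (\<Sum>i. ennreal (diameter (U i) powr s))" .
  qed
  also have "\<dots> \<le> hausdorff_measure s (cantor_set \<times> cantor_set)"
    unfolding hausdorff_measure_eq_SUP by (rule SUP_upper) simp
  finally have "1 / 16 \<le> hausdorff_measure s (cantor_set \<times> cantor_set)" .
  moreover have "(0::ennreal) < 1 / 16"
    by (simp add: ennreal_zero_less_divide)
  ultimately show ?thesis
    by (metis leD)
qed

section \<open>Upper bound from the triadic squares\<close>

text \<open>
  Covers are sequences of sets of positive diameter, so a finite family has to be continued by
  two-point sets. Their diameters are chosen with \<open>s\<close>-th powers \<open>\<epsilon> / 2, \<epsilon> / 4, \<dots>\<close>, which add at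
  most \<open>\<epsilon>\<close> to the sum.
\<close>

lemma hausdorff_premeasure_le_finite_cover:
  fixes E :: "'a::euclidean_space set"
  assumes "0 < s" "0 < \<delta>" "finite \<U>" "E \<subseteq> \<Union>\<U>"
    and \<U>: "\<And>V. V \<in> \<U> \<Longrightarrow> bounded V \<and> 0 < diameter V \<and> diameter V \<le> \<delta>"
  shows "hausdorff_premeasure s \<delta> E \<le> (\<Sum>V\<in>\<U>. ennreal (diameter V powr s))"
proof (rule ennreal_le_epsilon)
  fix e :: real assume e: "0 < e"
  \<comment> \<open>The cap by \<open>\<delta> powr s\<close> keeps the diameters of the padding sets at most \<open>\<delta>\<close>.\<close>
  define \<epsilon> where "\<epsilon> = min e (\<delta> powr s)"
  have \<epsilon>: "0 < \<epsilon>" "\<epsilon> \<le> e" "\<epsilon> \<le> \<delta> powr s"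
    using e \<open>0 < \<delta>\<close> by (auto simp: \<epsilon>_def)
  define d where "d i = (\<epsilon> / 2 ^ Suc i) powr (1 / s)" for i
  have d_pos: "0 < d i" for i using \<epsilon> by (simp add: d_def)
  have d_powr: "d i powr s = \<epsilon> / 2 ^ Suc i" for i
    using \<epsilon> \<open>0 < s\<close> by (simp add: d_def powr_powr)
  have d_le: "d i \<le> \<delta>" for i
  proof -
    have "\<epsilon> / 2 ^ Suc i \<le> \<epsilon>"
      using \<epsilon>(1) one_le_power[of "2::real" "Suc i"] by (simp add: divide_le_eq del: power_Suc)
    then have "d i \<le> (\<delta> powr s) powr (1 / s)"
      unfolding d_def using \<epsilon> \<open>0 < s\<close> by (intro powr_mono2) auto
    then show ?thesis using \<open>0 < s\<close> \<open>0 < \<delta>\<close> by (simp add: powr_powr)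
  qed
  obtain b :: 'a where b: "b \<in> Basis" using nonempty_Basis by blast
  obtain f where f: "bij_betw f {..<card \<U>} \<U>"
    using ex_bij_betw_nat_finite[OF \<open>finite \<U>\<close>] by (auto simp: atLeast0LessThan)
  define U where "U i = (if i < card \<U> then f i else {0, d i *\<^sub>R b})" for i
  have pad: "diameter {0, d i *\<^sub>R b} = d i" for i
  proof (rule antisym)
    show "diameter {0, d i *\<^sub>R b} \<le> d i"
      by (rule diameter_le) (use b d_pos[of i] in auto)
    show "d i \<le> diameter {0, d i *\<^sub>R b}"
      using diameter_bounded_bound[of "{0, d i *\<^sub>R b}" 0 "d i *\<^sub>R b"] b d_pos[of i]
      by simp
  qed
  have "U \<in> hausdorff_covers \<delta> E"
    unfolding hausdorff_covers_def
  proof (intro CollectI conjI allI)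
    show "E \<subseteq> (\<Union>i. U i)"
    proof
      fix x assume "x \<in> E"
      then obtain V where V: "V \<in> \<U>" "x \<in> V" using assms(4) by blast
      then have "V \<in> f ` {..<card \<U>}"
        using bij_betw_imp_surj_on[OF f] by simp
      then obtain i where "i < card \<U>" "f i = V" by auto
      then show "x \<in> (\<Union>i. U i)" using V by (auto simp: U_def)
    qed
    fix i
    have fi: "f i \<in> \<U>" if "i < card \<U>" using f that by (auto simp: bij_betw_def)
    show "bounded (U i)" "0 < diameter (U i)" "diameter (U i) \<le> \<delta>"
      using \<U>[OF fi] d_pos d_le by (auto simp: U_def pad)
  qed
  then have "hausdorff_premeasure s \<delta> E \<le> (\<Sum>i. ennreal (diameter (U i) powr s))"
    unfolding hausdorff_premeasure_def by (rule INF_lower)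
  also have "\<dots> \<le> (\<Sum>i. (if i < card \<U> then ennreal (diameter (f i) powr s) else 0)
      + ennreal (\<epsilon> * (1 / 2) ^ Suc i))"
    by (intro suminf_le) (auto simp: U_def pad d_powr power_divide)
  also have "\<dots> = (\<Sum>i. if i < card \<U> then ennreal (diameter (f i) powr s) else 0)
      + (\<Sum>i. ennreal (\<epsilon> * (1 / 2) ^ Suc i))"
    by (intro suminf_add[symmetric]) auto
  also have "(\<Sum>i. if i < card \<U> then ennreal (diameter (f i) powr s) else 0)
      = (\<Sum>i<card \<U>. ennreal (diameter (f i) powr s))"
    by (subst suminf_finite[of "{..<card \<U>}"]) auto
  also have "\<dots> = (\<Sum>V\<in>\<U>. ennreal (diameter V powr s))"
    by (rule sum.reindex_bij_betw[OF f])
  also have "(\<Sum>i. ennreal (\<epsilon> * (1 / 2) ^ Suc i)) = ennreal \<epsilon>"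
    using sums_mult[OF power_half_series, of \<epsilon>] \<epsilon>(1) by (intro suminf_ennreal_eq) auto
  also have "(\<Sum>V\<in>\<U>. ennreal (diameter V powr s)) + ennreal \<epsilon>
      \<le> (\<Sum>V\<in>\<U>. ennreal (diameter V powr s)) + ennreal e"
    using \<epsilon>(2) by (intro add_left_mono ennreal_leI)
  finally show "hausdorff_premeasure s \<delta> E \<le> (\<Sum>V\<in>\<U>. ennreal (diameter V powr s)) + ennreal e" .
qed

lemma cantor_set_triadic_cover:
  "\<exists>A. finite A \<and> card A \<le> 2 ^ n \<and> cantor_set \<subseteq> (\<Union>a\<in>A. {a..a + 1 / 3 ^ n})"
proof (induction n)
  case 0
  show ?case using cantor_set_subset_unit_interval by (intro exI[of _ "{0}"]) simp
next
  case (Suc n)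
  then obtain A where A: "finite A" "card A \<le> 2 ^ n"
    "cantor_set \<subseteq> (\<Union>a\<in>A. {a..a + 1 / 3 ^ n})" by blast
  let ?B = "cantor_map1 ` A \<union> cantor_map2 ` A"
  have "card ?B \<le> card (cantor_map1 ` A) + card (cantor_map2 ` A)" by (rule card_Un_le)
  also have "\<dots> \<le> card A + card A" by (intro add_mono card_image_le A)
  finally have card: "card ?B \<le> 2 ^ Suc n" using A(2) by simp
  have "cantor_set \<subseteq> (\<Union>a\<in>?B. {a..a + 1 / 3 ^ Suc n})"
  proof
    fix x assume "x \<in> cantor_set"
    then obtain f y where f: "f = cantor_map1 \<or> f = cantor_map2"
      and y: "y \<in> cantor_set" "x = f y" using cantor_set_props(3) by blast
    then obtain a where a: "a \<in> A" "a \<le> y" "y \<le> a + 1 / 3 ^ n" using A(3) by force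
    have "f y - f a = (y - a) / 3"
      using f by (auto simp: cantor_map1_def cantor_map2_def field_simps)
    moreover have "(y - a) / 3 \<le> 1 / 3 ^ Suc n"
      using a(3) by simp
    ultimately have "x \<in> {f a..f a + 1 / 3 ^ Suc n}" using a(2) y(2) by simp
    moreover have "f a \<in> ?B" using f a(1) by blast
    ultimately show "x \<in> (\<Union>a\<in>?B. {a..a + 1 / 3 ^ Suc n})" by blast
  qed
  then show ?case using card A(1) by (intro exI[of _ ?B]) simp
qed

lemma diameter_square:
  fixes a b r :: real
  assumes "0 \<le> r"
  shows "diameter ({a..a + r} \<times> {b..b + r}) = sqrt 2 * r"
proof -
  have "diameter ({a..a + r} \<times> {b..b + r}) = dist (a, b) (a + r, b + r)"
    using diameter_cbox[of "(a, b)" "(a + r, b + r)"] assms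
    by (simp add: cbox_Pair_eq Basis_prod_def)
  also have "\<dots> = sqrt 2 * r"
    using assms by (simp add: dist_Pair_Pair dist_real_def real_sqrt_mult)
  finally show ?thesis .
qed

lemma hausdorff_premeasure_cantor_square_le:
  assumes "0 < s" "sqrt 2 / 3 ^ n \<le> \<delta>"
  shows "hausdorff_premeasure s \<delta> (cantor_set \<times> cantor_set)
    \<le> ennreal (sqrt 2 powr s * (4 / 3 powr s) ^ n)"
proof -
  obtain A where A: "finite A" "card A \<le> 2 ^ n"
    "cantor_set \<subseteq> (\<Union>a\<in>A. {a..a + 1 / 3 ^ n})"
    using cantor_set_triadic_cover[of n] by blast
  define sq :: "real \<times> real \<Rightarrow> (real \<times> real) set"
    where "sq p = {fst p..fst p + 1 / 3 ^ n} \<times> {snd p..snd p + 1 / 3 ^ n}" for p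
  have diam: "diameter (sq p) = sqrt 2 / 3 ^ n" for p
    using diameter_square[of "1 / 3 ^ n"] by (simp add: sq_def)
  let ?\<U> = "sq ` (A \<times> A)"
  have "card ?\<U> \<le> card (A \<times> A)" by (rule card_image_le) (use A in simp)
  also have "\<dots> \<le> 2 ^ n * 2 ^ n"
    unfolding card_cartesian_product by (rule mult_mono) (use A in auto)
  also have "\<dots> = (4::nat) ^ n" by (simp flip: power_mult_distrib)
  finally have card: "real (card ?\<U>) \<le> 4 ^ n"
    using of_nat_mono[where 'a=real] by fastforce
  have d: "0 < sqrt 2 / 3 ^ n" by simp
  have "hausdorff_premeasure s \<delta> (cantor_set \<times> cantor_set)
      \<le> (\<Sum>V\<in>?\<U>. ennreal (diameter V powr s))"
  proof (rule hausdorff_premeasure_le_finite_cover)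
    show "0 < \<delta>" using d assms(2) by linarith
    show "cantor_set \<times> cantor_set \<subseteq> \<Union>?\<U>"
    proof
      fix p assume p: "p \<in> cantor_set \<times> cantor_set"
      have cover: "\<exists>a\<in>A. x \<in> {a..a + 1 / 3 ^ n}" if "x \<in> cantor_set" for x
        using subsetD[OF A(3) that] by (simp only: UN_iff)
      obtain a where a: "a \<in> A" "fst p \<in> {a..a + 1 / 3 ^ n}"
        using cover[of "fst p"] p by (auto simp: mem_Times_iff)
      obtain b where b: "b \<in> A" "snd p \<in> {b..b + 1 / 3 ^ n}"
        using cover[of "snd p"] p by (auto simp: mem_Times_iff)
      from a b have "(a, b) \<in> A \<times> A" "p \<in> sq (a, b)" by (simp_all add: sq_def mem_Times_iff)
      then show "p \<in> \<Union>?\<U>" by blast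
    qed
    fix V assume "V \<in> ?\<U>"
    then show "bounded V \<and> 0 < diameter V \<and> diameter V \<le> \<delta>"
      using assms(2) by (auto simp: diam) (auto simp: sq_def bounded_Times)
  qed (use A assms in auto)
  also have "\<dots> = (\<Sum>V\<in>?\<U>. ennreal ((sqrt 2 / 3 ^ n) powr s))"
    by (rule sum.cong) (auto simp: diam)
  also have "\<dots> = ennreal (real (card ?\<U>) * (sqrt 2 / 3 ^ n) powr s)"
    by (simp add: ennreal_mult ennreal_of_nat_eq_real_of_nat)
  also have "\<dots> \<le> ennreal (4 ^ n * (sqrt 2 / 3 ^ n) powr s)"
    using card by (intro ennreal_leI mult_right_mono) simp_all
  also have "4 ^ n * (sqrt 2 / 3 ^ n) powr s = sqrt 2 powr s * (4 / 3 powr s) ^ n"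
  proof -
    have "(3 ^ n) powr s = (3 powr s :: real) ^ n"
      by (induction n) (simp_all add: powr_mult)
    then show ?thesis by (simp add: powr_divide power_divide)
  qed
  finally show ?thesis .
qed

lemma eventually_triadic_diameter_le:
  assumes "0 < \<delta>"
  shows "\<forall>\<^sub>F n in sequentially. sqrt 2 / 3 ^ n \<le> \<delta>"
proof -
  have "(\<lambda>n. sqrt 2 * (1 / 3) ^ n) \<longlonglongrightarrow> sqrt 2 * 0"
    by (intro tendsto_intros) auto
  then have "\<forall>\<^sub>F n in sequentially. sqrt 2 * (1 / 3) ^ n < \<delta>"
    using assms by (intro order_tendstoD) auto
  then show ?thesis by eventually_elim (simp add: power_divide)
qed

lemma hausdorff_measure_cantor_square_le:
  "hausdorff_measure (log 3 4) (cantor_set \<times> cantor_set) \<le> ennreal (sqrt 2 powr log 3 4)"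
  unfolding hausdorff_measure_eq_SUP
proof (rule SUP_least)
  fix \<delta> :: real assume "\<delta> \<in> {0<..}"
  then obtain n where "sqrt 2 / 3 ^ n \<le> \<delta>"
    using eventually_happens'[OF _ eventually_triadic_diameter_le[of \<delta>]] by auto
  from hausdorff_premeasure_cantor_square_le[OF _ this, of "log 3 4"]
  show "hausdorff_premeasure (log 3 4) \<delta> (cantor_set \<times> cantor_set) \<le> ennreal (sqrt 2 powr log 3 4)"
    by simp
qed

text \<open>
  Here \<open>4 / 3 powr s < 1\<close>, so the sums over the triadic squares tend to 0, at every scale \<open>\<delta>\<close>.
\<close>

lemma hausdorff_measure_cantor_square_zero:
  assumes "log 3 4 < s"
  shows "hausdorff_measure s (cantor_set \<times> cantor_set) = 0"
proof -
  have s: "0 < s" using assms by (rule less_trans[rotated]) simp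
  have "hausdorff_premeasure s \<delta> (cantor_set \<times> cantor_set) \<le> 0" if "0 < \<delta>" for \<delta>
  proof (rule tendsto_lowerbound)
    have "3 powr log 3 4 < 3 powr s" using assms by (intro powr_less_mono) auto
    then have "4 / 3 powr s < 1" by simp
    then have "(\<lambda>n. (4 / 3 powr s) ^ n) \<longlonglongrightarrow> 0"
      by (intro LIMSEQ_power_zero) simp
    then show "(\<lambda>n. ennreal (sqrt 2 powr s * (4 / 3 powr s) ^ n)) \<longlonglongrightarrow> 0"
      unfolding ennreal_0[symmetric] by (intro tendsto_ennrealI tendsto_mult_right_zero)
    show "\<forall>\<^sub>F n in sequentially. hausdorff_premeasure s \<delta> (cantor_set \<times> cantor_set)
        \<le> ennreal (sqrt 2 powr s * (4 / 3 powr s) ^ n)"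
      using eventually_triadic_diameter_le[OF that]
      by eventually_elim (rule hausdorff_premeasure_cantor_square_le[OF s])
  qed simp
  then show ?thesis
    unfolding hausdorff_measure_eq_SUP by (auto intro!: antisym SUP_least)
qed

lemma hausdorff_dim_cantor_square: "hausdorff_dim (cantor_set \<times> cantor_set) = ereal (log 3 4)"
proof (rule antisym)
  have pos: "0 < log 3 (4::real)" by simp
  show "hausdorff_dim (cantor_set \<times> cantor_set) \<le> ereal (log 3 4)"
  proof (rule ereal_le_epsilon2)
    fix e :: real assume "0 < e"
    then have "hausdorff_measure (log 3 4 + e) (cantor_set \<times> cantor_set) = 0"
      by (intro hausdorff_measure_cantor_square_zero) simp
    then have "hausdorff_dim (cantor_set \<times> cantor_set) \<le> ereal (log 3 4 + e)"
      unfolding hausdorff_dim_def using pos \<open>0 < e\<close> by (intro INF_lower) auto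
    then show "hausdorff_dim (cantor_set \<times> cantor_set) \<le> ereal (log 3 4) + ereal e" by simp
  qed
  show "ereal (log 3 4) \<le> hausdorff_dim (cantor_set \<times> cantor_set)"
    unfolding hausdorff_dim_def
  proof (rule INF_greatest)
    fix s assume "s \<in> {s. 0 \<le> s \<and> hausdorff_measure s (cantor_set \<times> cantor_set) = 0}"
    then have "\<not> s \<le> log 3 4" using hausdorff_measure_cantor_square_nonzero by auto
    then show "ereal (log 3 4) \<le> ereal s" by simp
  qed
qed

theorem theorem1:
  "hausdorff_dim (cantor_set \<times> cantor_set) = ereal (log 3 4) \<and>
   hausdorff_measure (log 3 4) (cantor_set \<times> cantor_set) \<le> ennreal (sqrt 2 powr log 3 4)"
  using hausdorff_dim_cantor_square hausdorff_measure_cantor_square_le ..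

end
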